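(* Suppose Assumptions (i)–(iii) of the context hold. Let $\tilde{x}\in\mathbb{R}^d$ be any approximate lower-level solution (an approximation of $x^*$), let $\tilde{q}\in\mathbb{R}^d$ be any approximate solution of the linear system $A(\tilde{x})q = \nabla f(\tilde{x})$, and let $\tilde{h} := -B(\tilde{x})^T\tilde{q}$. Let $\tilde{\varepsilon} := \|\nabla g(\tilde{x})\|/\mu$ and $\tilde{\delta} := \|A(\tilde{x})\tilde{q} - \nabla f(\tilde{x})\|$. Let $L_{A^{-1}}$ be a Lipschitz constant of the map $x\mapsto A(x)^{-1}$ (which exists under these assumptions), and define $$c(x) := \frac{L_{\nabla f}\|B(x)\|}{\mu} + L_{A^{-1}}\|\nabla f(x)\|\,\|B(x)\| + \frac{L_B\|\nabla f(x)\|}{\mu}.$$ Then $\|\tilde{x}-x^*\|\le\tilde{\varepsilon}$, and the following a posteriori bound holds: $$\|\tilde{h}-h^*\| \le c(\tilde{x})\,\tilde{\varepsilon} + \frac{\|B(\tilde{x})\|}{\mu}\,\tilde{\delta} + \frac{L_B L_{\nabla f}}{\mu}\,\tilde{\varepsilon}^2.$$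
   Context: Setting: $g:\mathbb{R}^d\times\mathbb{R}^n\to\mathbb{R}$, $(y,\theta)\mapsto g(y,\theta)$, is the lower-level objective and $f:\mathbb{R}^d\to\mathbb{R}$ the differentiable upper-level function of a bilevel problem. $\|\cdot\|$ is the Euclidean norm for vectors and the operator 2-norm for matrices. The parameter $\theta\in\mathbb{R}^n$ is fixed and dropped from the notation: $\nabla g(y) := \partial_y g(y,\theta)\in\mathbb{R}^d$; $A(y) := \partial_{yy} g(y,\theta)\in\mathbb{R}^{d\times d}$ is the Hessian in $y$; $B(y) := \partial_y\partial_\theta g(y,\theta)\in\mathbb{R}^{d\times n}$ is the Jacobian of $\partial_y g$ with respect to $\theta$, $[B(y)]_{j,k} = \partial^2 g(y,\theta)/(\partial y_j\partial\theta_k)$; $x^* := \operatorname{arg\,min}_{x\in\mathbb{R}^d} g(x,\theta)$ is the unique lower-level minimizer; $\mu=\mu(\theta)$, $L=L(\theta)$. The exact hypergradient is $h^* := -B(x^* )^T A(x^* )^{-1}\nabla f(x^* )\in\mathbb{R}^n$. Assumptions: (i) $g$ is twice continuously differentiable in $y$ and there exist $0<\mu(\theta)\le L(\theta)$ such that $\mu(\theta) I \preceq \partial_{yy} g(y,\theta)\preceq L(\theta) I$ for all $y$ (where $M\preceq N$ means $N-M$ is positive semidefinite); moreover $g$, $\partial_y g$ and $\partial_{yy} g$ are continuous in $\theta$. (ii) $A$ and $B$ are Lipschitz continuous in $y$ with constants $L_A$ and $L_B$ respectively, uniformly for all $\theta$. (iii) $\nabla f$ is Lipschitz continuous with constant $L_{\nabla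 f}$. *)

theory Defs
  imports "HOL-Analysis.Analysis"
begin

(* The norm that the library puts on matrices is the Frobenius norm, and its
   Lipschitz predicate uses the induced metric.  The operator 2-norm is wanted
   here, both as a norm and in Lipschitz conditions on matrix-valued maps. *)
definition opnorm :: "real^'n^'m \<Rightarrow> real" where
  "opnorm M = onorm (\<lambda>v. M *v v)"

definition opnorm_lipschitz :: "real \<Rightarrow> (real^'k \<Rightarrow> real^'n^'m) \<Rightarrow> bool" where
  "opnorm_lipschitz K M \<longleftrightarrow>
     0 \<le> K \<and> (\<forall>x y. opnorm (M x - M y) \<le> K * norm (x - y))"

definition pos_semidef :: "real^'d^'d \<Rightarrow> bool" where
  "pos_semidef M \<longleftrightarrow> transpose M = M \<and> (\<forall>v. 0 \<le> v \<bullet> (M *v v))"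

definition loewner_le :: "real^'d^'d \<Rightarrow> real^'d^'d \<Rightarrow> bool" where
  "loewner_le M N \<longleftrightarrow> pos_semidef (N - M)"

end

theory Submission
  imports Defs
begin

text \<open>Everything rests on the coercivity
  \<open>m * (v \<bullet> v) \<le> v \<bullet> (M *v v)\<close> that the lower Loewner bound gives
  for every Hessian. Pointwise, with Cauchy-Schwarz, it bounds the inverse Hessian by 1/\<mu>, and
  the resolvent identity then makes the inverse Lipschitz
  (\<open>opnorm_lipschitz_matrix_inv\<close>). Along segments, it makes the gradient strongly
  monotone; so the minimizer exists, is a zero of the gradient, and its distance to any point is
  controlled by the gradient there (\<open>norm_diff_arg_min_le\<close>).

  The hypergradient error splits into four terms: the residual of the linear system and the changes
  of the inverse Hessian, of \<open>Df\<close> and of \<open>B\<close> between the approximate and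
  the exact point (\<open>hypergradient_perturbation\<close>). Each is a product of known
  bounds.\<close>

section \<open>Operator norm estimates\<close>

lemma norm_matrix_vector_le_opnorm:
  fixes M :: "real^'n^'m"
  shows "norm (M *v v) \<le> opnorm M * norm v"
  unfolding opnorm_def by (rule onorm[OF matrix_vector_mul_bounded_linear])

lemma opnorm_nonneg: "0 \<le> opnorm (M :: real^'n^'m)"
  unfolding opnorm_def by (rule onorm_pos_le[OF matrix_vector_mul_bounded_linear])

text \<open>Transposition does not increase the operator norm: pair the image u of \<open>w\<close>
  with itself, move the matrix across the inner product, and cancel one factor norm u.\<close>

lemma norm_transpose_vector_le_opnorm:
  fixes M :: "real^'n^'m"
  shows "norm (transpose M *v w) \<le> opnorm M * norm w"
proof (cases "transpose M *v w = 0")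
  case True
  then show ?thesis by (simp add: opnorm_nonneg)
next
  case False
  let ?u = "transpose M *v w"
  have "norm ?u * norm ?u = ?u \<bullet> ?u"
    by (simp add: dot_square_norm power2_eq_square)
  also have "\<dots> = w \<bullet> (M *v ?u)"
    by (metis dot_lmul_matrix inner_commute transpose_matrix_vector)
  also have "\<dots> \<le> norm w * norm (M *v ?u)"
    by (rule norm_cauchy_schwarz)
  also have "\<dots> \<le> norm w * (opnorm M * norm ?u)"
    by (intro mult_left_mono norm_matrix_vector_le_opnorm) simp
  finally have "norm ?u * norm ?u \<le> (opnorm M * norm w) * norm ?u"
    by (simp add: ac_simps)
  with False show ?thesis by simp
qed

section \<open>Coercive matrices and their inverses\<close>

lemma loewner_le_quadratic_form:
  fixes M :: "real^'d^'d"
  assumes "loewner_le (m *\<^sub>R mat 1) M"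
  shows "m * (v \<bullet> v) \<le> v \<bullet> (M *v v)"
  using assms
  by (simp add: loewner_le_def pos_semidef_def matrix_vector_mult_diff_rdistrib
      scaleR_matrix_vector_assoc[symmetric] inner_diff_right)

context
  fixes M :: "real^'d^'d" and m :: real
  assumes m_pos: "0 < m"
    and elliptic: "\<And>v. m * (v \<bullet> v) \<le> v \<bullet> (M *v v)"
begin

text \<open>Cauchy-Schwarz applied to the coercivity bound. It yields both the trivial kernel, hence
  invertibility of a square matrix, and the bound 1/m on the inverse.\<close>

lemma norm_le_matrix_vector_of_elliptic: "m * norm v \<le> norm (M *v v)"
proof (cases "v = 0")
  case False
  have "m * norm v * norm v \<le> v \<bullet> (M *v v)"
    using elliptic[of v] by (simp add: dot_square_norm power2_eq_square mult.assoc)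
  also have "\<dots> \<le> norm v * norm (M *v v)"
    by (rule norm_cauchy_schwarz)
  finally show ?thesis using False by simp
qed simp

lemma invertible_of_elliptic: "invertible M"
proof -
  have "v = 0" if "M *v v = 0" for v
    using norm_le_matrix_vector_of_elliptic[of v] m_pos that
    by (simp add: mult_le_0_iff)
  then show ?thesis
    by (metis invertible_left_inverse matrix_left_invertible_ker)
qed

lemma matrix_inv_vector_of_elliptic:
  "M *v (matrix_inv M *v w) = w" "matrix_inv M *v (M *v w) = w"
proof -
  have "M ** matrix_inv M = mat 1 \<and> matrix_inv M ** M = mat 1"
    using invertible_of_elliptic unfolding matrix_inv_def invertible_def
    by (rule someI_ex[where P = "\<lambda>N. M ** N = mat 1 \<and> N ** M = mat 1"])
  then show "M *v (matrix_inv M *v w) = w" "matrix_inv M *v (M *v w) = w"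
    by (simp_all add: matrix_vector_mul_assoc)
qed

lemma norm_matrix_inv_vector_of_elliptic: "norm (matrix_inv M *v w) \<le> norm w / m"
  using norm_le_matrix_vector_of_elliptic[of "matrix_inv M *v w"] m_pos
  by (simp add: matrix_inv_vector_of_elliptic field_simps)

end

text \<open>By the resolvent identity, the difference of two inverses is the difference of the
  matrices, with reversed sign, between the two inverses. Each inverse contributes a factor 1/m,
  hence the square.\<close>

lemma opnorm_lipschitz_matrix_inv:
  fixes M :: "real^'k \<Rightarrow> real^'d^'d"
  assumes m: "0 < m"
    and ell: "\<And>x v. m * (v \<bullet> v) \<le> v \<bullet> (M x *v v)"
    and lip: "opnorm_lipschitz K M"
  shows "opnorm_lipschitz (K / m\<^sup>2) (\<lambda>x. matrix_inv (M x))"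
  unfolding opnorm_lipschitz_def
proof (intro conjI allI)
  show "0 \<le> K / m\<^sup>2"
    using lip by (simp add: opnorm_lipschitz_def)
  fix x y
  have "norm ((matrix_inv (M x) - matrix_inv (M y)) *v w) \<le> K / m\<^sup>2 * norm (x - y) * norm w" for w
  proof -
    let ?u = "matrix_inv (M y) *v w"
    have "(matrix_inv (M x) - matrix_inv (M y)) *v w = matrix_inv (M x) *v ((M y - M x) *v ?u)"
      by (simp add: matrix_vector_mult_diff_rdistrib matrix_vector_mult_diff_distrib
          matrix_inv_vector_of_elliptic[OF m ell])
    also have "norm \<dots> \<le> norm ((M y - M x) *v ?u) / m"
      by (rule norm_matrix_inv_vector_of_elliptic[OF m ell])
    also have "\<dots> \<le> (opnorm (M y - M x) * norm ?u) / m"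
      using m by (intro divide_right_mono norm_matrix_vector_le_opnorm) simp
    also have "\<dots> \<le> ((K * norm (y - x)) * (norm w / m)) / m"
      using m lip
      by (intro divide_right_mono mult_mono norm_matrix_inv_vector_of_elliptic[OF m ell])
        (auto simp: opnorm_lipschitz_def)
    finally show ?thesis
      by (simp add: power2_eq_square norm_minus_commute)
  qed
  then show "opnorm (matrix_inv (M x) - matrix_inv (M y)) \<le> K / m\<^sup>2 * norm (x - y)"
    unfolding opnorm_def by (rule onorm_le)
qed

section \<open>Strong convexity and the lower-level minimizer\<close>

context
  fixes g :: "real^'d \<Rightarrow> real" and G :: "real^'d \<Rightarrow> real^'d"
    and H :: "real^'d \<Rightarrow> real^'d^'d" and m :: real
  assumes grad: "\<And>y. GDERIV g y :> G y"
    and hess: "\<And>y. (G has_derivative (\<lambda>v. H y *v v)) (at y)"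
    and pos: "0 < m"
    and ell: "\<And>y v. m * (v \<bullet> v) \<le> v \<bullet> (H y *v v)"
begin

text \<open>On the segment from \<open>x\<close> to \<open>y\<close>, the gradient component along
  the segment has the quadratic form of \<open>H\<close> as derivative. Subtracting the guaranteed
  linear growth leaves a nondecreasing function, compared at 0 and 1.\<close>

lemma gradient_strongly_monotone: "m * (norm (y - x))\<^sup>2 \<le> (G y - G x) \<bullet> (y - x)"
proof -
  define v where "v = y - x"
  let ?\<phi> = "\<lambda>t. G (x + t *\<^sub>R v) \<bullet> v - t * (m * (v \<bullet> v))"
  have D: "(?\<phi> has_real_derivative (v \<bullet> (H (x + t *\<^sub>R v) *v v) - m * (v \<bullet> v))) (at t)" for t
  proof -
    have "((\<lambda>t. G (x + t *\<^sub>R v)) has_derivative (\<lambda>s. H (x + t *\<^sub>R v) *v (s *\<^sub>R v))) (at t)"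
      by (rule has_derivative_compose[where f = "\<lambda>t. x + t *\<^sub>R v", OF _ hess])
        (auto intro!: derivative_eq_intros)
    then show ?thesis
      unfolding has_field_derivative_def
      by (auto intro!: derivative_eq_intros
          simp: matrix_vector_mult_scaleR inner_commute algebra_simps)
  qed
  have nonneg: "0 \<le> v \<bullet> (H (x + t *\<^sub>R v) *v v) - m * (v \<bullet> v)" for t
    by (simp add: ell)
  have "?\<phi> 0 \<le> ?\<phi> 1"
    by (rule DERIV_nonneg_imp_nondecreasing[of 0 1 ?\<phi>]) (simp, blast intro: D nonneg)
  then show ?thesis
    by (simp add: v_def inner_diff_left power2_norm_eq_inner)
qed

text \<open>The same comparison one order lower: the derivative of the remainder along the segment
  is now nonnegative by strong monotonicity of the gradient.\<close>

lemma strongly_convex_lower_bound: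
  "g x + G x \<bullet> (y - x) + m / 2 * (norm (y - x))\<^sup>2 \<le> g y"
proof -
  define v where "v = y - x"
  let ?\<phi> = "\<lambda>t. g (x + t *\<^sub>R v) - t * (G x \<bullet> v) - m / 2 * t\<^sup>2 * (v \<bullet> v)"
  have D: "(?\<phi> has_real_derivative ((G (x + t *\<^sub>R v) - G x) \<bullet> v - m * t * (v \<bullet> v))) (at t)" for t
  proof -
    have "((\<lambda>t. g (x + t *\<^sub>R v)) has_derivative (\<lambda>s. (s *\<^sub>R v) \<bullet> G (x + t *\<^sub>R v))) (at t)"
      by (rule has_derivative_compose[where f = "\<lambda>t. x + t *\<^sub>R v", OF _ grad[unfolded gderiv_def]])
        (auto intro!: derivative_eq_intros)
    then show ?thesis
      unfolding has_field_derivative_def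
      by (auto intro!: derivative_eq_intros simp: inner_commute algebra_simps)
  qed
  have nonneg: "0 \<le> (G (x + t *\<^sub>R v) - G x) \<bullet> v - m * t * (v \<bullet> v)" if "0 \<le> t" for t
  proof (cases "t = 0")
    case False
    \<comment> \<open>Strong monotonicity for the displacement \<open>t *\<^sub>R v\<close> carries
      one factor \<open>t\<close> too many, which is then cancelled.\<close>
    have "m * t\<^sup>2 * (v \<bullet> v) \<le> t * ((G (x + t *\<^sub>R v) - G x) \<bullet> v)"
      using gradient_strongly_monotone[of "x + t *\<^sub>R v" x]
      by (simp add: power_mult_distrib power2_norm_eq_inner algebra_simps)
    then have "t * (m * t * (v \<bullet> v)) \<le> t * ((G (x + t *\<^sub>R v) - G x) \<bullet> v)"
      by (simp only: power2_eq_square ac_simps)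
    then show ?thesis using that False by simp
  qed simp
  have "?\<phi> 0 \<le> ?\<phi> 1"
    by (rule DERIV_nonneg_imp_nondecreasing[of 0 1 ?\<phi>]) (simp, blast intro: D nonneg)
  then show ?thesis
    by (simp add: v_def power2_norm_eq_inner)
qed

text \<open>Without existence, \<open>arg_min\<close> would be an arbitrary point. A minimum over a
  large compact ball is global, since outside the ball the quadratic growth keeps \<open>g\<close>
  above its value at the centre.\<close>

lemma strongly_convex_has_min: "\<exists>x. \<forall>y. g x \<le> g y"
proof -
  \<comment> \<open>Beyond this radius the quadratic term of the lower bound around 0 outweighs the
    linear one.\<close>
  define R where "R = 2 * norm (G 0) / m"
  have "continuous_on (cball 0 R) g"
    using grad
    by (metis continuous_at_imp_continuous_on gderiv_def has_derivative_continuous)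
  moreover have "0 \<le> R"
    using pos by (simp add: R_def)
  ultimately obtain x where x: "\<And>y. y \<in> cball 0 R \<Longrightarrow> g x \<le> g y"
    using continuous_attains_inf[of "cball 0 R" g] by (meson cball_eq_empty compact_cball not_less)
  have "g x \<le> g y" if "R < norm y" for y
  proof -
    have "0 \<le> norm y * (m / 2 * norm y - norm (G 0))"
      using that pos by (intro mult_nonneg_nonneg) (auto simp: R_def field_simps)
    moreover have "- (norm (G 0) * norm y) \<le> G 0 \<bullet> y"
      using Cauchy_Schwarz_ineq2[of "G 0" y] by linarith
    moreover note strongly_convex_lower_bound[of 0 y]
    ultimately have "g 0 \<le> g y"
      by (simp add: algebra_simps power2_eq_square)
    then show ?thesis using x[of 0] \<open>0 \<le> R\<close> by simp
  qed
  with x show ?thesis by (meson mem_cball_0 not_less)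
qed

lemma gradient_arg_min_eq_0: "G (arg_min g (\<lambda>x. True)) = 0"
proof -
  let ?x = "arg_min g (\<lambda>x. True)"
  have "is_arg_min g (\<lambda>x. True) ?x"
    unfolding arg_min_def using strongly_convex_has_min
    by (intro someI_ex[where P = "is_arg_min g (\<lambda>x. True)"]) (auto simp: is_arg_min_linorder)
  then have "\<And>y. g ?x \<le> g y"
    by (simp add: is_arg_min_linorder)
  then have "(\<lambda>h. h \<bullet> G ?x) = (\<lambda>h. 0)"
    using differential_zero_maxmin[of ?x UNIV g "\<lambda>h. h \<bullet> G ?x"] grad[of ?x]
    by (auto simp: gderiv_def)
  then show ?thesis by (metis inner_eq_zero_iff)
qed

text \<open>Strong monotonicity between \<open>x\<close> and the minimizer, where the gradient
  vanishes, followed by Cauchy-Schwarz and cancellation of the distance.\<close>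

lemma norm_diff_arg_min_le: "norm (x - arg_min g (\<lambda>x. True)) \<le> norm (G x) / m"
proof -
  let ?d = "x - arg_min g (\<lambda>x. True)"
  have "m * (norm ?d)\<^sup>2 \<le> G x \<bullet> ?d"
    using gradient_strongly_monotone[of x "arg_min g (\<lambda>x. True)"] gradient_arg_min_eq_0 by simp
  also have "\<dots> \<le> norm (G x) * norm ?d"
    by (rule norm_cauchy_schwarz)
  finally show ?thesis
    using pos by (cases "?d = 0") (simp_all add: power2_eq_square field_simps)
qed

end

section \<open>Perturbation of the hypergradient\<close>

text \<open>The difference is telescoped so that \<open>F y\<close> is the only quantity at the exact point \<open>y\<close> left to
  estimate by its value at \<open>x\<close>; that estimate produces the quadratic term.\<close>
lemma hypergradient_perturbation:
  fixes A :: "real^'d \<Rightarrow> real^'d^'d" and B :: "real^'d \<Rightarrow> real^'n^'d"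
    and F :: "real^'d \<Rightarrow> real^'d"
  assumes m: "0 < m"
    and ell: "\<And>x v. m * (v \<bullet> v) \<le> v \<bullet> (A x *v v)"
    and lipA: "opnorm_lipschitz K (\<lambda>x. matrix_inv (A x))"
    and lipB: "opnorm_lipschitz L\<^sub>B B"
    and lipF: "L\<^sub>f-lipschitz_on UNIV F"
    and e: "norm (x - y) \<le> e"
  shows "norm (- (transpose (B x) *v q) - - (transpose (B y) *v (matrix_inv (A y) *v F y)))
    \<le> (L\<^sub>f * opnorm (B x) / m + K * norm (F x) * opnorm (B x) + L\<^sub>B * norm (F x) / m) * e
      + opnorm (B x) / m * norm (A x *v q - F x) + L\<^sub>B * L\<^sub>f / m * e\<^sup>2"
proof -
  let ?I = "\<lambda>x. matrix_inv (A x)" and ?T = "\<lambda>x. transpose (B x)" and ?b = "opnorm (B x)"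
  note inv = matrix_inv_vector_of_elliptic[OF m ell]
  note inv_le = norm_matrix_inv_vector_of_elliptic[OF m ell]
  have K: "0 \<le> K" "opnorm (?I x - ?I y) \<le> K * norm (x - y)"
    and LB: "0 \<le> L\<^sub>B" "opnorm (B x - B y) \<le> L\<^sub>B * norm (x - y)"
    using lipA lipB by (auto simp: opnorm_lipschitz_def)
  have Lf: "0 \<le> L\<^sub>f" "norm (F x - F y) \<le> L\<^sub>f * norm (x - y)"
    using lipF by (auto simp: lipschitz_on_def dist_norm)
  have e0: "0 \<le> e"
    using e norm_ge_zero order_trans by blast
  have Ke: "opnorm (?I x - ?I y) \<le> K * e" and LBe: "opnorm (B x - B y) \<le> L\<^sub>B * e"
    and Lfe: "norm (F x - F y) \<le> L\<^sub>f * e"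
    using K LB Lf e by (meson mult_left_mono order_trans)+
  have Fy: "norm (F y) \<le> norm (F x) + L\<^sub>f * e"
    using Lfe norm_triangle_ineq2[of "F y" "F x"] by (simp add: norm_minus_commute)
  \<comment> \<open>The inner vector is \<open>q\<close> minus the exact solution of the system at
    \<open>x\<close>, written through the residual. The other three terms replace \<open>x\<close>
    by \<open>y\<close> in one factor at a time: the inverse, then \<open>F\<close>, then
    \<open>B\<close>.\<close>
  let ?r1 = "?T x *v (?I x *v (A x *v q - F x))"
  let ?r2 = "?T x *v ((?I x - ?I y) *v F x)"
  let ?r3 = "?T x *v (?I y *v (F x - F y))"
  let ?r4 = "transpose (B x - B y) *v (?I y *v F y)"
  have tdiff: "transpose (B x - B y) = ?T x - ?T y"
    by (simp add: transpose_def vec_eq_iff)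
  have split: "- (?T x *v q) - - (?T y *v (?I y *v F y)) = - (?r1 + ?r2 + ?r3 + ?r4)"
    by (simp add: tdiff matrix_vector_mult_diff_rdistrib matrix_vector_mult_diff_distrib inv)
  have r1: "norm ?r1 \<le> ?b * (norm (A x *v q - F x) / m)"
    by (rule order_trans[OF norm_transpose_vector_le_opnorm])
      (intro mult_left_mono inv_le opnorm_nonneg)
  have r2: "norm ?r2 \<le> ?b * ((K * e) * norm (F x))"
    by (rule order_trans[OF norm_transpose_vector_le_opnorm])
      (intro mult_left_mono opnorm_nonneg order_trans[OF norm_matrix_vector_le_opnorm]
        mult_right_mono Ke norm_ge_zero)
  have r3: "norm ?r3 \<le> ?b * ((L\<^sub>f * e) / m)"
    using m
    by (intro order_trans[OF norm_transpose_vector_le_opnorm] mult_left_mono opnorm_nonneg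
        order_trans[OF inv_le] divide_right_mono Lfe) simp
  have r4: "norm ?r4 \<le> (L\<^sub>B * e) * ((norm (F x) + L\<^sub>f * e) / m)"
    using m LB e0
    by (intro order_trans[OF norm_transpose_vector_le_opnorm] mult_mono LBe
        order_trans[OF inv_le] divide_right_mono Fy) auto
  have "norm (?r1 + ?r2 + ?r3 + ?r4) \<le> norm ?r1 + norm ?r2 + norm ?r3 + norm ?r4"
    by (intro norm_triangle_mono order_refl)
  also have "\<dots> \<le> ?b * (norm (A x *v q - F x) / m) + ?b * ((K * e) * norm (F x))
      + ?b * ((L\<^sub>f * e) / m) + (L\<^sub>B * e) * ((norm (F x) + L\<^sub>f * e) / m)"
    using r1 r2 r3 r4 by linarith
  also have "\<dots> = (L\<^sub>f * ?b / m + K * norm (F x) * ?b + L\<^sub>B * norm (F x) / m) * e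
      + ?b / m * norm (A x *v q - F x) + L\<^sub>B * L\<^sub>f / m * e\<^sup>2"
    using m by (simp add: field_simps power2_eq_square)
  finally show ?thesis
    unfolding split norm_minus_cancel .
qed

text \<open>The error bound is claimed for every Lipschitz constant \<open>K\<close> of the inverse
  Hessian; the separate existence claim shows that this is not vacuous.\<close>

theorem theorem9:
  fixes g :: "real^'d \<Rightarrow> real^'n \<Rightarrow> real"
    and G :: "real^'d \<Rightarrow> real^'n \<Rightarrow> real^'d"
    and A :: "real^'d \<Rightarrow> real^'n \<Rightarrow> real^'d^'d"
    and B :: "real^'d \<Rightarrow> real^'n \<Rightarrow> real^'n^'d"
    and f :: "real^'d \<Rightarrow> real"
    and Df :: "real^'d \<Rightarrow> real^'d"
    and \<mu> L :: "real^'n \<Rightarrow> real"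
    and L\<^sub>A L\<^sub>B L\<^sub>f :: real
    and \<theta> :: "real^'n"
    and x' q' :: "real^'d"
  assumes gradient_g: "\<And>y \<theta>. GDERIV (\<lambda>z. g z \<theta>) y :> G y \<theta>"
    and hessian_g: "\<And>y \<theta>. ((\<lambda>z. G z \<theta>) has_derivative (\<lambda>v. A y \<theta> *v v)) (at y)"
    and mixed_g: "\<And>y \<theta> j k.
      ((\<lambda>t. G y (\<theta> + t *\<^sub>R axis k 1) $ j) has_real_derivative B y \<theta> $ j $ k) (at 0)"
    and hessian_cont: "\<And>\<theta>. continuous_on UNIV (\<lambda>y. A y \<theta>)"
    and mu_L: "\<And>\<theta>. 0 < \<mu> \<theta> \<and> \<mu> \<theta> \<le> L \<theta>"
    and hessian_bounds: "\<And>y \<theta>. loewner_le (\<mu> \<theta> *\<^sub>R mat 1) (A y \<theta>)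
                              \<and> loewner_le (A y \<theta>) (L \<theta> *\<^sub>R mat 1)"
    and cont_theta_g: "\<And>y. continuous_on UNIV (\<lambda>\<theta>. g y \<theta>)"
    and cont_theta_G: "\<And>y. continuous_on UNIV (\<lambda>\<theta>. G y \<theta>)"
    and cont_theta_A: "\<And>y. continuous_on UNIV (\<lambda>\<theta>. A y \<theta>)"
    and lipschitz_A: "\<And>\<theta>. opnorm_lipschitz L\<^sub>A (\<lambda>y. A y \<theta>)"
    and lipschitz_B: "\<And>\<theta>. opnorm_lipschitz L\<^sub>B (\<lambda>y. B y \<theta>)"
    and gradient_f: "\<And>x. GDERIV f x :> Df x"
    and lipschitz_Df: "L\<^sub>f-lipschitz_on UNIV Df"
  defines "xs \<equiv> arg_min (\<lambda>x. g x \<theta>) (\<lambda>x. True)"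
  defines "hs \<equiv> - (transpose (B xs \<theta>) *v (matrix_inv (A xs \<theta>) *v Df xs))"
  defines "h' \<equiv> - (transpose (B x' \<theta>) *v q')"
  defines "\<epsilon> \<equiv> norm (G x' \<theta>) / \<mu> \<theta>"
  defines "\<delta> \<equiv> norm (A x' \<theta> *v q' - Df x')"
  defines "c \<equiv> \<lambda>K x. L\<^sub>f * opnorm (B x \<theta>) / \<mu> \<theta>
                   + K * norm (Df x) * opnorm (B x \<theta>)
                   + L\<^sub>B * norm (Df x) / \<mu> \<theta>"
  shows "(\<exists>K. opnorm_lipschitz K (\<lambda>x. matrix_inv (A x \<theta>))) \<and>
         norm (x' - xs) \<le> \<epsilon> \<and>
         (\<forall>K. opnorm_lipschitz K (\<lambda>x. matrix_inv (A x \<theta>)) \<longrightarrow>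
            norm (h' - hs) \<le> c K x' * \<epsilon> + opnorm (B x' \<theta>) / \<mu> \<theta> * \<delta>
                              + L\<^sub>B * L\<^sub>f / \<mu> \<theta> * \<epsilon>\<^sup>2)"
proof (intro conjI allI impI)
  have m: "0 < \<mu> \<theta>"
    using mu_L by blast
  have ell: "\<mu> \<theta> * (v \<bullet> v) \<le> v \<bullet> (A y \<theta> *v v)" for y v
    using hessian_bounds loewner_le_quadratic_form by blast
  show "\<exists>K. opnorm_lipschitz K (\<lambda>x. matrix_inv (A x \<theta>))"
    using opnorm_lipschitz_matrix_inv[OF m ell lipschitz_A] by blast
  show dist: "norm (x' - xs) \<le> \<epsilon>"
    unfolding xs_def \<epsilon>_def by (rule norm_diff_arg_min_le[OF gradient_g hessian_g m ell])
  show "norm (h' - hs) \<le> c K x' * \<epsilon> + opnorm (B x' \<theta>) / \<mu> \<theta> * \<delta> + L\<^sub>B * L\<^sub>f / \<mu> \<theta> * \<epsilon>\<^sup>2"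
    if "opnorm_lipschitz K (\<lambda>x. matrix_inv (A x \<theta>))" for K
    unfolding h'_def hs_def c_def \<delta>_def
    by (rule hypergradient_perturbation[OF m ell that lipschitz_B lipschitz_Df dist])
qed

end
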